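(* Let $\mu,\nu\in\mathcal P_1(\mathbb R)$. The weak monotone rearrangement $T$ of $\mu,\nu$ is the unique (up to $\mu$-a.s. equality) admissible map which has slope $1$ on each interval $T^{-1}(I)$, where $I$ is irreducible with respect to $(T(\mu),\nu)$. That is: $T$ has slope $1$ on $T^{-1}(I)$ for every interval $I$ that is irreducible with respect to $(T(\mu),\nu)$, and any admissible map $S$ that has slope $1$ on $S^{-1}(I)$ for every interval $I$ that is irreducible with respect to $(S(\mu),\nu)$ satisfies $S=T$ $\mu$-a.s.
   Context: $\mathcal P_1(\mathbb R)$ is the set of Borel probability measures on $\mathbb R$ with finite first moment; $S(\mu)$ is the push-forward of $\mu$ under $S$; $\eta\leq_c\nu$ (convex order) means $\int\phi\,d\eta\leq\int\phi\,d\nu$ for all convex $\phi\colon\mathbb R\to\mathbb R$. A function $S\colon\mathbb R\to\mathbb R$ is admissible (with respect to $\mu,\nu$) if it is increasing (nondecreasing), 1-Lipschitz, and $S(\mu)\leq_c\nu$. The weak monotone rearrangement of $\mu,\nu$ is the ($\mu$-a.s. unique, existing) admissible map $T$ such that $S(\mu)\leq_c T(\mu)$ for every admissible $S$. Irreducible intervals: for $\eta\in\mathcal P_1(\mathbb R)$ put $u_\eta(y):=\int_{\mathbb R}|x-y|\,\eta(dx)$. If $\eta\leq_c\nu$ then $u_\eta\leq u_\nu$ and the open set $\{u_\eta<u_\nu\}$ is a union of at most countably many disjoint open intervals (its connected components); these are the intervals irreducible with respect to $(\eta,\nu)$. Maps are considered up to $\mu$-null sets: "$S$ has slope $1$ on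 $S^{-1}(I)$" means that there is a Borel set $\Gamma$ with $\mu(\Gamma)=1$ such that $S(x)-S(y)=x-y$ for all $x,y\in\Gamma\cap S^{-1}(I)$. *)

theory Defs
  imports "HOL-Probability.Probability"
begin

definition P1 :: "real measure set" where
  "P1 = {\<mu>. real_distribution \<mu> \<and> integrable \<mu> (\<lambda>x. x)}"

text \<open>The integral of a convex function against a measure in \<^term>\<open>P1\<close> may be \<open>+\<infinity>\<close>, where the
  Bochner integral would return 0; so it is taken in the extended reals, as the integral of the
  positive part minus that of the negative part (\<^const>\<open>ennreal\<close> maps negative numbers to 0).
  A convex function on the reals has an affine minorant, so against a measure in \<^term>\<open>P1\<close> the
  subtracted term is finite.\<close>

definition ext_integral :: "real measure \<Rightarrow> (real \<Rightarrow> real) \<Rightarrow> ereal" where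
  "ext_integral \<eta> \<phi> =
     enn2ereal (\<integral>\<^sup>+ x. ennreal (\<phi> x) \<partial>\<eta>) - enn2ereal (\<integral>\<^sup>+ x. ennreal (- \<phi> x) \<partial>\<eta>)"

definition convex_order :: "real measure \<Rightarrow> real measure \<Rightarrow> bool" (infix "\<le>\<^sub>c" 50) where
  "\<eta> \<le>\<^sub>c \<nu> \<longleftrightarrow> (\<forall>\<phi>. convex_on UNIV \<phi> \<longrightarrow> ext_integral \<eta> \<phi> \<le> ext_integral \<nu> \<phi>)"

definition pushforward :: "(real \<Rightarrow> real) \<Rightarrow> real measure \<Rightarrow> real measure" where
  "pushforward S \<mu> = distr \<mu> borel S"

definition admissible :: "real measure \<Rightarrow> real measure \<Rightarrow> (real \<Rightarrow> real) \<Rightarrow> bool" where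
  "admissible \<mu> \<nu> S \<longleftrightarrow> mono S \<and> 1-lipschitz_on UNIV S \<and> pushforward S \<mu> \<le>\<^sub>c \<nu>"

definition weak_monotone_rearrangement ::
  "real measure \<Rightarrow> real measure \<Rightarrow> (real \<Rightarrow> real) \<Rightarrow> bool" where
  "weak_monotone_rearrangement \<mu> \<nu> T \<longleftrightarrow>
     admissible \<mu> \<nu> T \<and>
     (\<forall>S. admissible \<mu> \<nu> S \<longrightarrow> pushforward S \<mu> \<le>\<^sub>c pushforward T \<mu>)"

definition potential :: "real measure \<Rightarrow> real \<Rightarrow> real" where
  "potential \<eta> y = (\<integral>x. \<bar>x - y\<bar> \<partial>\<eta>)"

definition irreducible_intervals :: "real measure \<Rightarrow> real measure \<Rightarrow> real set set" where
  "irreducible_intervals \<eta> \<nu> = components {y. potential \<eta> y < potential \<nu> y}"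

text \<open>Slope 1 up to \<open>\<mu>\<close>-null sets; the identity is required across the whole of \<open>A\<close>, also for
  points of \<open>A\<close> separated by a gap in the support of \<open>\<mu>\<close>.\<close>

definition has_slope_one_on ::
  "real measure \<Rightarrow> (real \<Rightarrow> real) \<Rightarrow> real set \<Rightarrow> bool" where
  "has_slope_one_on \<mu> S A \<longleftrightarrow>
     (\<exists>\<Gamma>\<in>sets borel. measure \<mu> \<Gamma> = 1 \<and> (\<forall>x\<in>\<Gamma> \<inter> A. \<forall>y\<in>\<Gamma> \<inter> A. S x - S y = x - y))"

end

theory Submission
  imports Defs
begin

text \<open>The convex order amounts to equality of means and the pointwise order of potentials.

  Suppose \<open>S\<close> has slope one on its irreducible intervals and the potential of \<open>T(\<mu>)\<close> exceeds that of
  \<open>S(\<mu>)\<close> at \<open>y\<close>. The potentials agree at the end points of the irreducible interval of \<open>y\<close>, so comparing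
  \<open>\<bar>t - y\<bar> - \<bar>t - a\<bar>\<close> under \<open>S\<close> and \<open>T\<close> for \<open>a\<close> the left and the right end point yields \<open>x\<^sub>1 < x\<^sub>2\<close> with
  \<open>S x\<^sub>1, S x\<^sub>2\<close> in that interval, \<open>T x\<^sub>1 < S x\<^sub>1\<close> and \<open>S x\<^sub>2 < T x\<^sub>2\<close>; then \<open>T\<close> increases by more than
  \<open>x\<^sub>2 - x\<^sub>1\<close>, which is impossible. Increasing maps with equal potentials agree almost everywhere.

  Conversely, if the displacement \<open>x - T x\<close> is not almost surely constant over an irreducible interval,
  then the image can be spread slightly inside this interval, and \<open>T\<close> is not maximal.\<close>

section \<open>Measures with finite first moment and their potentials\<close>

lemma P1D:
  assumes "\<mu> \<in> P1"
  shows "prob_space \<mu>" "sets \<mu> = sets borel" "space \<mu> = UNIV" "integrable \<mu> (\<lambda>x. x)"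
  using assms real_distribution.space_eq_univ
  by (auto simp: P1_def real_distribution_def real_distribution_axioms_def)

lemma P1_measurable:
  assumes "\<mu> \<in> P1"
  shows "borel_measurable \<mu> = (borel_measurable borel :: (real \<Rightarrow> 'a::topological_space) set)"
  using P1D[OF assms] by (intro measurable_cong_sets) auto

lemma ext_integral_integrable:
  assumes "integrable \<eta> \<phi>"
  shows "ext_integral \<eta> \<phi> = ereal (\<integral>x. \<phi> x \<partial>\<eta>)"
proof -
  have "(\<integral>\<^sup>+ x. ennreal (\<phi> x) \<partial>\<eta>) \<noteq> \<infinity>" "(\<integral>\<^sup>+ x. ennreal (- \<phi> x) \<partial>\<eta>) \<noteq> \<infinity>"
    using assms by (auto simp: real_integrable_def)
  then obtain a b where ab: "a \<ge> 0" "b \<ge> 0" "(\<integral>\<^sup>+ x. ennreal (\<phi> x) \<partial>\<eta>) = ennreal a"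
      "(\<integral>\<^sup>+ x. ennreal (- \<phi> x) \<partial>\<eta>) = ennreal b"
    by (metis ennreal_cases infinity_ennreal_def)
  then show ?thesis
    unfolding ext_integral_def real_lebesgue_integral_def[OF assms]
    by (simp add: enn2ereal_ennreal)
qed

lemma integrable_abs_affine:
  assumes "\<eta> \<in> P1"
  shows "integrable \<eta> (\<lambda>x. a * x + b)" "integrable \<eta> (\<lambda>x. \<bar>a * x + b\<bar>)"
    "integrable \<eta> (\<lambda>x. \<bar>x - y\<bar>)"
proof -
  interpret prob_space \<eta> using P1D[OF assms] by simp
  show "integrable \<eta> (\<lambda>x. a * x + b)" "integrable \<eta> (\<lambda>x. \<bar>a * x + b\<bar>)"
    "integrable \<eta> (\<lambda>x. \<bar>x - y\<bar>)"
    using P1D(4)[OF assms] by auto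
qed

lemma integral_affine:
  assumes "\<eta> \<in> P1"
  shows "(\<integral>x. a * x + b \<partial>\<eta>) = a * (\<integral>x. x \<partial>\<eta>) + b"
proof -
  interpret prob_space \<eta> using P1D[OF assms] by simp
  show ?thesis
    using P1D(4)[OF assms] by (simp add: prob_space)
qed

text \<open>The identity and its negative are both convex.\<close>

lemma convex_order_imp_mean_eq:
  assumes "\<eta> \<in> P1" "\<nu> \<in> P1" "\<eta> \<le>\<^sub>c \<nu>"
  shows "(\<integral>x. x \<partial>\<eta>) = (\<integral>x. x \<partial>\<nu>)"
proof -
  have "convex_on UNIV (\<lambda>x::real. x)" "convex_on UNIV (\<lambda>x::real. - x)"
    by (auto simp: convex_on_def algebra_simps)
  then have "ext_integral \<eta> (\<lambda>x. x) \<le> ext_integral \<nu> (\<lambda>x. x)"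
    "ext_integral \<eta> (\<lambda>x. - x) \<le> ext_integral \<nu> (\<lambda>x. - x)"
    using assms(3) unfolding convex_order_def by blast+
  with P1D(4)[OF assms(1)] P1D(4)[OF assms(2)] show ?thesis
    by (auto simp: ext_integral_integrable)
qed

lemma convex_order_imp_potential_le:
  assumes "\<eta> \<in> P1" "\<nu> \<in> P1" "\<eta> \<le>\<^sub>c \<nu>"
  shows "potential \<eta> y \<le> potential \<nu> y"
proof -
  have "convex_on UNIV (\<lambda>x::real. \<bar>x - y\<bar>)"
    using convex_on_dist[OF convex_UNIV, of y] by (simp add: dist_real_def abs_minus_commute)
  then have "ext_integral \<eta> (\<lambda>x. \<bar>x - y\<bar>) \<le> ext_integral \<nu> (\<lambda>x. \<bar>x - y\<bar>)"
    using assms(3) unfolding convex_order_def by blast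
  with integrable_abs_affine(3)[OF assms(1)] integrable_abs_affine(3)[OF assms(2)] show ?thesis
    by (auto simp: ext_integral_integrable potential_def)
qed

text \<open>The potential is 1-Lipschitz. Continuity makes
  \<open>{y. potential \<eta> y < potential \<nu> y}\<close> open and bounds the gap of the
  potentials away from 0 on compact parts of it.\<close>

lemma continuous_on_potential:
  assumes "\<eta> \<in> P1"
  shows "continuous_on UNIV (potential \<eta>)"
proof -
  interpret prob_space \<eta> using P1D[OF assms] by simp
  have "\<bar>potential \<eta> y - potential \<eta> z\<bar> \<le> \<bar>y - z\<bar>" for y z
  proof -
    have "potential \<eta> y - potential \<eta> z = (\<integral>x. \<bar>x - y\<bar> - \<bar>x - z\<bar> \<partial>\<eta>)"
      unfolding potential_def using integrable_abs_affine(3)[OF assms] by simp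
    also have "\<bar>\<dots>\<bar> \<le> (\<integral>x. \<bar>\<bar>x - y\<bar> - \<bar>x - z\<bar>\<bar> \<partial>\<eta>)"
      by (rule integral_abs_bound)
    also have "\<dots> \<le> (\<integral>x. \<bar>y - z\<bar> \<partial>\<eta>)"
      using integrable_abs_affine(3)[OF assms] by (intro integral_mono) auto
    finally show ?thesis by (simp add: prob_space)
  qed
  then have "1-lipschitz_on UNIV (potential \<eta>)"
    by (intro lipschitz_onI) (auto simp: dist_real_def)
  then show ?thesis by (rule lipschitz_on_continuous_on)
qed

section \<open>Potentials determine the convex order\<close>

lemma convex_subgradient_exists:
  fixes f :: "real \<Rightarrow> real"
  assumes "convex_on UNIV f"
  shows "\<exists>s. \<forall>x y. f x + s x * (y - x) \<le> f y"
proof -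
  have "\<exists>m. \<forall>y. f x + m * (y - x) \<le> f y" for x
    using convex_le_Inf_differential[OF assms, of x] by auto
  then show ?thesis by metis
qed

text \<open>The positive part of \<open>t\<close> is \<open>(\<bar>t\<bar> + t) / 2\<close>: the
  absolute value integrates to a multiple of a potential (a constant if \<open>a = 0\<close>), and
  the linear term is fixed by the mean.\<close>

lemma nn_integral_affine_pos_le:
  assumes "\<eta> \<in> P1" "\<nu> \<in> P1" and mean: "(\<integral>x. x \<partial>\<eta>) = (\<integral>x. x \<partial>\<nu>)"
    and pot: "\<And>y. potential \<eta> y \<le> potential \<nu> y"
  shows "(\<integral>\<^sup>+x. ennreal (a * x + b) \<partial>\<eta>) \<le> (\<integral>\<^sup>+x. ennreal (a * x + b) \<partial>\<nu>)"
proof -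
  have *: "(\<integral>\<^sup>+x. ennreal (a * x + b) \<partial>\<rho>) =
      ennreal (((\<integral>x. \<bar>a * x + b\<bar> \<partial>\<rho>) + (a * (\<integral>x. x \<partial>\<rho>) + b)) / 2)" if "\<rho> \<in> P1" for \<rho>
  proof -
    note i = integrable_abs_affine[OF that]
    have pos_part: "ennreal t = ennreal ((\<bar>t\<bar> + t) / 2)" for t
      by (cases "t \<ge> 0") (auto simp: ennreal_neg)
    have "(\<integral>\<^sup>+x. ennreal (a * x + b) \<partial>\<rho>) = (\<integral>\<^sup>+x. ennreal ((\<bar>a * x + b\<bar> + (a * x + b)) / 2) \<partial>\<rho>)"
      using pos_part by (intro nn_integral_cong) blast
    also have "\<dots> = ennreal (\<integral>x. (\<bar>a * x + b\<bar> + (a * x + b)) / 2 \<partial>\<rho>)"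
    proof (rule nn_integral_eq_integral)
      show "integrable \<rho> (\<lambda>x. (\<bar>a * x + b\<bar> + (a * x + b)) / 2)"
        by (rule integrable_divide[OF Bochner_Integration.integrable_add[OF i(2) i(1)]])
      show "AE x in \<rho>. 0 \<le> (\<bar>a * x + b\<bar> + (a * x + b)) / 2" by (intro AE_I2) auto
    qed
    also have "(\<integral>x. (\<bar>a * x + b\<bar> + (a * x + b)) / 2 \<partial>\<rho>) =
        ((\<integral>x. \<bar>a * x + b\<bar> \<partial>\<rho>) + (\<integral>x. a * x + b \<partial>\<rho>)) / 2"
      using Bochner_Integration.integral_add[OF i(2)[of a b] i(1)[of a b]] by simp
    finally show ?thesis by (simp add: integral_affine[OF that])
  qed
  have "(\<integral>x. \<bar>a * x + b\<bar> \<partial>\<eta>) \<le> (\<integral>x. \<bar>a * x + b\<bar> \<partial>\<nu>)"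
  proof (cases "a = 0")
    case True
    then show ?thesis
      using P1D(1)[OF assms(1)] P1D(1)[OF assms(2)] by (simp add: prob_space.prob_space)
  next
    case False
    then have "\<bar>a * x + b\<bar> = \<bar>a\<bar> * \<bar>x - (- b / a)\<bar>" for x
      by (simp add: abs_mult[symmetric] field_simps)
    then show ?thesis
      using pot[of "- b / a"] by (simp add: potential_def mult_left_mono)
  qed
  then show ?thesis
    using mean by (simp add: *[OF assms(1)] *[OF assms(2)] ennreal_leI)
qed

section \<open>Approximation of convex functions by sums of positive parts of affine
  functions\<close>

definition tangent :: "(real \<Rightarrow> real) \<Rightarrow> (real \<Rightarrow> real) \<Rightarrow> real \<Rightarrow> real \<Rightarrow> real" where
  "tangent g s p x = g p + s p * (x - p)"

text \<open>The sum of the positive parts of the differences of consecutive tangents at \<open>0, c, 2c, \<dots>\<close>;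
  if the tangent at \<open>0\<close> vanishes, it equals their supremum because consecutive tangents cross between
  their base points. Positive parts arise because \<^const>\<open>ennreal\<close> maps negative numbers to 0.\<close>

definition tangent_sum :: "(real \<Rightarrow> real) \<Rightarrow> (real \<Rightarrow> real) \<Rightarrow> real \<Rightarrow> real \<Rightarrow> ennreal" where
  "tangent_sum g s c x =
     (\<Sum>i. ennreal (tangent g s (c * real (Suc i)) x - tangent g s (c * real i) x))"

context
  fixes g s :: "real \<Rightarrow> real"
  assumes subgradient: "\<And>x y. g x + s x * (y - x) \<le> g y"
    and g_0: "g 0 = 0" and s_0: "s 0 = 0"
begin

text \<open>Sum of the subgradient inequalities at both points. The product form covers both orders,
  since the grid step \<open>c\<close> may have either sign.\<close>

lemma subgradient_mono: "0 \<le> (s x - s y) * (x - y)"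
  using subgradient[of x y] subgradient[of y x] by (simp add: algebra_simps)

text \<open>The premise puts \<open>x\<close> at or beyond the new base point in the direction of
  \<open>c\<close>. At \<open>p + c\<close> the new tangent touches \<open>g\<close>, hence is not
  below the old one, and its slope keeps it so from there on.\<close>

lemma tangent_le_next:
  assumes "0 \<le> c * (x - (p + c))"
  shows "tangent g s p x \<le> tangent g s (p + c) x"
proof (cases "c = 0")
  case False
  have "0 \<le> (s (p + c) - s p) * c"
    using subgradient_mono[of "p + c" p] by simp
  with assms False have "0 \<le> (s (p + c) - s p) * (x - (p + c))"
    by (auto simp: zero_le_mult_iff)
  with subgradient[of p "p + c"] show ?thesis by (simp add: tangent_def algebra_simps)
qed simp

lemma tangent_next_le:
  assumes "c * (x - p) \<le> 0"
  shows "tangent g s (p + c) x \<le> tangent g s p x"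
proof (cases "c = 0")
  case False
  have "0 \<le> (s (p + c) - s p) * c"
    using subgradient_mono[of "p + c" p] by simp
  with assms False have "(s (p + c) - s p) * (x - p) \<le> 0"
    by (auto simp: zero_le_mult_iff mult_le_0_iff)
  with subgradient[of "p + c" p] show ?thesis by (simp add: tangent_def algebra_simps)
qed simp

lemma slope_nonneg:
  assumes "0 \<le> c * (x - c * real k)"
  shows "0 \<le> s (c * real k) * (x - c * real k)"
proof (cases "c = 0 \<or> k = 0")
  case False
  have "0 \<le> (s (c * real k) * c) * real k"
    using subgradient_mono[of "c * real k" 0] s_0 by (simp add: algebra_simps)
  with False have "0 \<le> s (c * real k) * c"
    by (auto simp: zero_le_mult_iff)
  with assms False show ?thesis by (auto simp: zero_le_mult_iff)
qed (auto simp: s_0)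

text \<open>While the base points have not passed \<open>x\<close>, all differences are nonnegative,
  so truncation loses nothing and the sum telescopes, starting from the zero tangent at 0.\<close>

lemma tangent_sum_partial_eq:
  assumes "0 \<le> c * (x - c * real k)"
  shows "(\<Sum>i<k. ennreal (tangent g s (c * real (Suc i)) x - tangent g s (c * real i) x))
     = ennreal (tangent g s (c * real k) x)"
proof -
  have step: "tangent g s (c * real i) x \<le> tangent g s (c * real (Suc i)) x" if "i < k" for i
  proof -
    have "c * c * real (Suc i) \<le> c * c * real k"
      using that by (intro mult_left_mono) auto
    with assms have "0 \<le> c * (x - (c * real i + c))"
      by (auto simp: algebra_simps)
    then show ?thesis
      using tangent_le_next[of c x "c * real i"] by (simp add: algebra_simps)
  qed
  then have "(\<Sum>i<k. ennreal (tangent g s (c * real (Suc i)) x - tangent g s (c * real i) x))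
      = ennreal (\<Sum>i<k. tangent g s (c * real (Suc i)) x - tangent g s (c * real i) x)"
    by (intro sum_ennreal) auto
  also have "\<dots> = ennreal (tangent g s (c * real k) x)"
    using sum_lessThan_telescope[of "\<lambda>i. tangent g s (c * real i) x" k]
    by (simp add: tangent_def g_0 s_0)
  finally show ?thesis .
qed

text \<open>As long as the base points have not passed \<open>x\<close>, the partial sum is the
  current tangent, and one more positive part gives the maximum of two tangents, both below
  \<open>g\<close>. Later terms vanish.\<close>

lemma tangent_sum_le: "tangent_sum g s c x \<le> ennreal (g x)"
  unfolding tangent_sum_def
proof (rule suminf_le_const[OF summableI])
  fix N
  show "(\<Sum>i<N. ennreal (tangent g s (c * real (Suc i)) x - tangent g s (c * real i) x)) \<le> ennreal (g x)"
  proof (induction N)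
    case (Suc N)
    let ?l = "\<lambda>i. tangent g s (c * real i) x"
    show ?case
    proof (cases "0 \<le> c * (x - c * real N)")
      case True
      have "?l N \<le> g x" "?l (Suc N) \<le> g x"
        using subgradient by (auto simp: tangent_def)
      moreover have "0 \<le> ?l N"
      proof -
        have "0 \<le> g (c * real N)" using subgradient[of 0] g_0 s_0 by simp
        with slope_nonneg[OF True] show ?thesis by (simp add: tangent_def)
      qed
      moreover have "ennreal (?l N) + ennreal (?l (Suc N) - ?l N) = ennreal (max (?l N) (?l (Suc N)))"
        using \<open>0 \<le> ?l N\<close> by (cases "?l N \<le> ?l (Suc N)") (auto simp: ennreal_plus[symmetric] ennreal_neg max_def simp del: ennreal_plus)
      ultimately show ?thesis
        using tangent_sum_partial_eq[of c x N] True by (simp add: ennreal_leI)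
    next
      case False
      then have "?l (Suc N) \<le> ?l N"
        using tangent_next_le[of c x "c * real N"] by (simp add: algebra_simps)
      with Suc.IH show ?thesis by (simp add: ennreal_neg)
    qed
  qed simp
qed

text \<open>A grid contributes nothing on the other side of 0, so the grids in the two directions
  can be added without interference.\<close>

lemma tangent_sum_eq_0:
  assumes "c * x \<le> 0"
  shows "tangent_sum g s c x = 0"
proof -
  have "tangent g s (c * real (Suc i)) x \<le> tangent g s (c * real i) x" for i
  proof -
    have "0 \<le> c * c * real i" by simp
    then have "c * (x - c * real i) \<le> 0" using assms by (simp add: algebra_simps)
    then show ?thesis
      using tangent_next_le[of c x "c * real i"] by (simp add: algebra_simps)
  qed
  then show ?thesis by (simp add: tangent_sum_def ennreal_neg)
qed

text \<open>The first \<open>k\<close> terms give the tangent at \<open>c * real k\<close>, which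
  does not decrease from its base point towards \<open>x\<close>.\<close>

lemma le_tangent_sum:
  assumes "0 \<le> c * (x - c * real k)"
  shows "ennreal (g (c * real k)) \<le> tangent_sum g s c x"
proof -
  have "ennreal (g (c * real k)) \<le> ennreal (tangent g s (c * real k) x)"
    using slope_nonneg[OF assms] by (intro ennreal_leI) (simp add: tangent_def)
  also have "\<dots> = (\<Sum>i<k. ennreal (tangent g s (c * real (Suc i)) x - tangent g s (c * real i) x))"
    using tangent_sum_partial_eq[of c x k] assms by simp
  also have "\<dots> \<le> tangent_sum g s c x"
    unfolding tangent_sum_def by (intro sum_le_suminf summableI) auto
  finally show ?thesis .
qed

lemma le_liminf_tangent_sum:
  assumes "continuous_on UNIV g"
  shows "ennreal (g x) \<le> liminf (\<lambda>n. tangent_sum g s (sgn x / real (Suc n)) x)"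
proof -
  \<comment> \<open>\<open>k n\<close> counts the whole steps of length
    \<open>1 / real (Suc n)\<close> from 0 towards \<open>x\<close>; the last grid point not beyond
    \<open>x\<close> tends to \<open>x\<close>. For \<open>x = 0\<close> the step is 0.\<close>
  define k where "k n = nat \<lfloor>\<bar>x\<bar> * real (Suc n)\<rfloor>" for n
  have k: "real (k n) \<le> \<bar>x\<bar> * real (Suc n)" "\<bar>x\<bar> * real (Suc n) - 1 \<le> real (k n)" for n
    unfolding k_def by (simp_all add: floor_le_iff)
  have "(\<lambda>n. real (k n) / real (Suc n)) \<longlonglongrightarrow> \<bar>x\<bar>"
  proof (rule tendsto_sandwich)
    have "\<bar>x\<bar> - 1 / real (Suc n) \<le> real (k n) / real (Suc n)" for n
      using divide_right_mono[OF k(2)[of n], of "real (Suc n)"] by (simp add: diff_divide_distrib)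
    then show "\<forall>\<^sub>F n in sequentially. \<bar>x\<bar> - 1 / real (Suc n) \<le> real (k n) / real (Suc n)"
      by simp
    have "real (k n) / real (Suc n) \<le> \<bar>x\<bar>" for n
      using divide_right_mono[OF k(1)[of n], of "real (Suc n)"] by simp
    then show "\<forall>\<^sub>F n in sequentially. real (k n) / real (Suc n) \<le> \<bar>x\<bar>" by simp
    show "(\<lambda>n. \<bar>x\<bar> - 1 / real (Suc n)) \<longlonglongrightarrow> \<bar>x\<bar>"
      using LIMSEQ_inverse_real_of_nat_add_minus[of "\<bar>x\<bar>"] by (simp add: inverse_eq_divide)
  qed simp
  then have "(\<lambda>n. sgn x * (real (k n) / real (Suc n))) \<longlonglongrightarrow> sgn x * \<bar>x\<bar>"
    by (intro tendsto_mult_left)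
  then have lim: "(\<lambda>n. sgn x / real (Suc n) * real (k n)) \<longlonglongrightarrow> x"
    by (simp add: sgn_mult_abs)
  then have "(\<lambda>n. ennreal (g (sgn x / real (Suc n) * real (k n)))) \<longlonglongrightarrow> ennreal (g x)"
    using assms by (intro tendsto_ennrealI continuous_on_tendsto_compose[of UNIV g]) auto
  then have "ennreal (g x) = liminf (\<lambda>n. ennreal (g (sgn x / real (Suc n) * real (k n))))"
    by (simp add: lim_imp_Liminf)
  also have "\<dots> \<le> liminf (\<lambda>n. tangent_sum g s (sgn x / real (Suc n)) x)"
  proof (intro Liminf_mono always_eventually allI le_tangent_sum)
    fix n
    have "x - sgn x / real (Suc n) * real (k n) = sgn x * (\<bar>x\<bar> - real (k n) / real (Suc n))"
      using sgn_mult_abs[of x] by (simp add: right_diff_distrib)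
    moreover have "0 \<le> \<bar>x\<bar> - real (k n) / real (Suc n)"
      using k(1)[of n] by (simp add: field_simps)
    ultimately show "0 \<le> sgn x / real (Suc n) * (x - sgn x / real (Suc n) * real (k n))"
      by (simp add: sgn_if)
  qed
  finally show ?thesis .
qed

lemma nn_integral_convex_le:
  assumes "\<eta> \<in> P1" "\<nu> \<in> P1" "(\<integral>x. x \<partial>\<eta>) = (\<integral>x. x \<partial>\<nu>)"
    and "\<And>y. potential \<eta> y \<le> potential \<nu> y"
    and cont: "continuous_on UNIV g"
  shows "(\<integral>\<^sup>+x. ennreal (g x) \<partial>\<eta>) \<le> (\<integral>\<^sup>+x. ennreal (g x) \<partial>\<nu>)"
proof -
  define B where "B n x = tangent_sum g s (1 / real (Suc n)) x + tangent_sum g s (- 1 / real (Suc n)) x" for n x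
  have [measurable]: "(\<lambda>x. tangent_sum g s c x) \<in> borel_measurable \<rho>" if "\<rho> \<in> P1" for \<rho> c
    unfolding tangent_sum_def tangent_def P1_measurable[OF that] by measurable
  have sum_eq: "(\<integral>\<^sup>+x. tangent_sum g s c x \<partial>\<rho>)
      = (\<Sum>i. \<integral>\<^sup>+x. ennreal (tangent g s (c * real (Suc i)) x - tangent g s (c * real i) x) \<partial>\<rho>)"
    if "\<rho> \<in> P1" for \<rho> c
    unfolding tangent_sum_def tangent_def
    by (rule nn_integral_suminf) (simp add: P1_measurable[OF that])
  have "(\<integral>\<^sup>+x. ennreal (tangent g s p x - tangent g s q x) \<partial>\<eta>)
      \<le> (\<integral>\<^sup>+x. ennreal (tangent g s p x - tangent g s q x) \<partial>\<nu>)" for p q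
  proof -
    have "tangent g s p x - tangent g s q x
        = (s p - s q) * x + (g p - s p * p - g q + s q * q)" for x
      by (simp add: tangent_def algebra_simps)
    then show ?thesis using nn_integral_affine_pos_le[OF assms(1-4)] by simp
  qed
  then have sum_le: "(\<integral>\<^sup>+x. tangent_sum g s c x \<partial>\<eta>) \<le> (\<integral>\<^sup>+x. tangent_sum g s c x \<partial>\<nu>)" for c
    unfolding sum_eq[OF assms(1)] sum_eq[OF assms(2)] by (intro suminf_le summableI) auto
  have B_le: "B n x \<le> ennreal (g x)" for n x
  proof (cases "x \<ge> 0")
    case True
    then have "- 1 / real (Suc n) * x \<le> 0" by simp
    from tangent_sum_eq_0[OF this] tangent_sum_le show ?thesis by (simp add: B_def)
  next
    case False
    then have "1 / real (Suc n) * x \<le> 0" by (simp add: field_simps)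
    from tangent_sum_eq_0[OF this] tangent_sum_le show ?thesis by (simp add: B_def)
  qed
  have "ennreal (g x) \<le> liminf (\<lambda>n. B n x)" for x
  proof -
    have "tangent_sum g s (sgn x / real (Suc n)) x \<le> B n x" for n
      using tangent_sum_eq_0[of 0 x] by (auto simp: B_def sgn_if)
    then have "liminf (\<lambda>n. tangent_sum g s (sgn x / real (Suc n)) x) \<le> liminf (\<lambda>n. B n x)"
      by (intro Liminf_mono always_eventually) auto
    with le_liminf_tangent_sum[OF cont] show ?thesis by (rule order_trans)
  qed
  then have "(\<integral>\<^sup>+x. ennreal (g x) \<partial>\<eta>) \<le> (\<integral>\<^sup>+x. liminf (\<lambda>n. B n x) \<partial>\<eta>)"
    by (intro nn_integral_mono) auto
  also have "\<dots> \<le> liminf (\<lambda>n. \<integral>\<^sup>+x. B n x \<partial>\<eta>)"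
    using assms(1) by (intro nn_integral_liminf) (simp add: B_def)
  also have "\<dots> \<le> liminf (\<lambda>n. \<integral>\<^sup>+x. B n x \<partial>\<nu>)"
    using assms(1,2) sum_le
    by (intro Liminf_mono always_eventually) (auto simp: B_def nn_integral_add intro!: add_mono)
  also have "\<dots> \<le> liminf (\<lambda>n. \<integral>\<^sup>+x. ennreal (g x) \<partial>\<nu>)"
    by (intro Liminf_mono always_eventually allI nn_integral_mono B_le)
  finally show ?thesis by (simp add: Liminf_const)
qed

end

text \<open>Subtracting the supporting line at 0 leaves a nonnegative convex \<open>g\<close>, which
  is compared by tangent sums; the line has equal integrals because the means agree.\<close>

lemma convex_orderI:
  assumes P1: "\<eta> \<in> P1" "\<nu> \<in> P1" and mean: "(\<integral>x. x \<partial>\<eta>) = (\<integral>x. x \<partial>\<nu>)"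
    and pot: "\<And>y. potential \<eta> y \<le> potential \<nu> y"
  shows "\<eta> \<le>\<^sub>c \<nu>"
  unfolding convex_order_def
proof (intro allI impI)
  fix \<phi> :: "real \<Rightarrow> real" assume \<phi>: "convex_on UNIV \<phi>"
  obtain s where s: "\<And>x y. \<phi> x + s x * (y - x) \<le> \<phi> y"
    using convex_subgradient_exists[OF \<phi>] by blast
  define l where "l x = s 0 * x + \<phi> 0" for x
  define g where "g x = \<phi> x - l x" for x
  have cont: "continuous_on UNIV \<phi>" by (rule convex_on_continuous[OF open_UNIV \<phi>])
  then have cont_g: "continuous_on UNIV g"
    unfolding g_def l_def by (intro continuous_intros)
  have le: "(\<integral>\<^sup>+x. ennreal (g x) \<partial>\<eta>) \<le> (\<integral>\<^sup>+x. ennreal (g x) \<partial>\<nu>)"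
  proof (rule nn_integral_convex_le[OF _ _ _ P1 mean pot cont_g, of "\<lambda>x. s x - s 0"])
    show "g x + (s x - s 0) * (y - x) \<le> g y" for x y
      using s[of x y] by (simp add: g_def l_def algebra_simps)
  qed (auto simp: g_def l_def)
  have g_nonneg: "0 \<le> g x" for x using s[of 0 x] by (simp add: g_def l_def algebra_simps)
  have int_l: "integrable \<rho> l" if "\<rho> \<in> P1" for \<rho>
    unfolding l_def using integrable_abs_affine(1)[OF that] .
  have meas: "g \<in> borel_measurable \<rho>" "\<phi> \<in> borel_measurable \<rho>" if "\<rho> \<in> P1" for \<rho>
    using borel_measurable_continuous_onI[OF cont] borel_measurable_continuous_onI[OF cont_g]
    by (auto simp: P1_measurable[OF that])
  show "ext_integral \<eta> \<phi> \<le> ext_integral \<nu> \<phi>"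
  proof (cases "(\<integral>\<^sup>+x. ennreal (g x) \<partial>\<nu>) = \<infinity>")
    \<comment> \<open>Here the right-hand side is infinite: \<open>\<phi>\<close> differs from
      \<open>g\<close> by the integrable \<open>l\<close>, and its negative part is at most
      \<open>\<bar>l x\<bar>\<close>.\<close>
    case True
    note [measurable] = meas[OF P1(2)] int_l[OF P1(2), THEN borel_measurable_integrable]
    have fin: "(\<integral>\<^sup>+x. ennreal \<bar>l x\<bar> \<partial>\<nu>) < \<infinity>"
      using int_l[OF P1(2)] by (simp add: integrable_iff_bounded)
    have "(\<integral>\<^sup>+x. ennreal (g x) \<partial>\<nu>) \<le> (\<integral>\<^sup>+x. ennreal (\<phi> x) + ennreal \<bar>l x\<bar> \<partial>\<nu>)"
    proof (rule nn_integral_mono)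
      fix x show "ennreal (g x) \<le> ennreal (\<phi> x) + ennreal \<bar>l x\<bar>"
      proof (cases "\<phi> x \<ge> 0")
        case True
        then show ?thesis by (simp add: g_def ennreal_plus[symmetric] ennreal_leI del: ennreal_plus)
      next
        case False
        then show ?thesis by (simp add: g_def ennreal_neg ennreal_leI)
      qed
    qed
    also have "\<dots> = (\<integral>\<^sup>+x. ennreal (\<phi> x) \<partial>\<nu>) + (\<integral>\<^sup>+x. ennreal \<bar>l x\<bar> \<partial>\<nu>)"
      by (rule nn_integral_add) auto
    finally have inf: "(\<integral>\<^sup>+x. ennreal (\<phi> x) \<partial>\<nu>) = \<infinity>"
      using True fin by (auto simp: top_unique)
    have "(\<integral>\<^sup>+x. ennreal (- \<phi> x) \<partial>\<nu>) \<le> (\<integral>\<^sup>+x. ennreal \<bar>l x\<bar> \<partial>\<nu>)"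
      using g_nonneg by (intro nn_integral_mono ennreal_leI) (smt (verit) g_def)
    with fin have "(\<integral>\<^sup>+x. ennreal (- \<phi> x) \<partial>\<nu>) \<noteq> \<infinity>" by (auto simp: top_unique)
    then obtain b where "(\<integral>\<^sup>+x. ennreal (- \<phi> x) \<partial>\<nu>) = ennreal b" "b \<ge> 0"
      by (metis ennreal_cases infinity_ennreal_def)
    with inf show ?thesis
      by (simp add: ext_integral_def enn2ereal_ennreal)
  next
    case False
    have int_g: "integrable \<rho> g" if "\<rho> \<in> P1" "(\<integral>\<^sup>+x. ennreal (g x) \<partial>\<rho>) \<noteq> \<infinity>" for \<rho>
      using that meas(1)[OF that(1)] g_nonneg by (auto simp: integrable_iff_bounded less_top)
    have \<phi>_eq: "\<phi> = (\<lambda>x. g x + l x)" by (auto simp: g_def)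
    have ig: "integrable \<eta> g" "integrable \<nu> g"
      using int_g[OF P1(1)] int_g[OF P1(2)] neq_top_trans[OF _ le] False by auto
    then have "(\<integral>x. g x \<partial>\<eta>) \<le> (\<integral>x. g x \<partial>\<nu>)"
      using le g_nonneg by (simp add: nn_integral_eq_integral integral_nonneg_AE)
    moreover have "(\<integral>x. l x \<partial>\<eta>) = (\<integral>x. l x \<partial>\<nu>)"
      unfolding l_def integral_affine[OF P1(1)] integral_affine[OF P1(2)] mean ..
    moreover have "ext_integral \<rho> \<phi> = ereal ((\<integral>x. g x \<partial>\<rho>) + (\<integral>x. l x \<partial>\<rho>))"
      if "\<rho> \<in> P1" "integrable \<rho> g" for \<rho>
      unfolding \<phi>_eq using that int_l[OF that(1)] by (subst ext_integral_integrable) auto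
    ultimately show ?thesis using ig P1 by simp
  qed
qed

section \<open>Push-forwards under increasing 1-Lipschitz maps\<close>

text \<open>Two-sided bounds on increments pass directly to convex combinations of maps.\<close>

lemma mono_lipschitz_iff:
  fixes S :: "real \<Rightarrow> real"
  shows "mono S \<and> 1-lipschitz_on UNIV S \<longleftrightarrow>
    (\<forall>x y. x \<le> y \<longrightarrow> S x \<le> S y \<and> S y - S x \<le> y - x)" (is "?l \<longleftrightarrow> ?r")
proof
  assume ?l
  then show ?r
    using lipschitz_onD[of 1 UNIV S] by (simp add: mono_def dist_real_def) (smt (verit))
next
  assume r: ?r
  have "\<bar>S x - S y\<bar> \<le> \<bar>x - y\<bar>" for x y
    using r[rule_format, of x y] r[rule_format, of y x] by (cases "x \<le> y") auto
  with r show ?l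
    by (auto simp: mono_def dist_real_def intro!: lipschitz_onI)
qed

lemma admissible_increment:
  assumes "admissible \<mu> \<nu> S" "x \<le> y"
  shows "S x \<le> S y" "S y - S x \<le> y - x"
  using assms mono_lipschitz_iff[of S] by (auto simp: admissible_def)

text \<open>Linear growth gives integrability. Potentials and means of images become integrals over
  \<mu>, so different maps can be compared pointwise.\<close>

lemma pushforward_lipschitz:
  assumes \<mu>: "\<mu> \<in> P1" and S: "1-lipschitz_on UNIV S"
  shows "S \<in> borel_measurable borel" "integrable \<mu> S" "integrable \<mu> (\<lambda>x. \<bar>S x - y\<bar>)"
    "pushforward S \<mu> \<in> P1"
    "potential (pushforward S \<mu>) y = (\<integral>x. \<bar>S x - y\<bar> \<partial>\<mu>)"
    "(\<integral>x. x \<partial>(pushforward S \<mu>)) = (\<integral>x. S x \<partial>\<mu>)"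
proof -
  interpret prob_space \<mu> using P1D[OF \<mu>] by simp
  show meas: "S \<in> borel_measurable borel"
    using lipschitz_on_continuous_on[OF S] by (rule borel_measurable_continuous_onI)
  then have meas': "S \<in> borel_measurable \<mu>" by (simp add: P1_measurable[OF \<mu>])
  show int: "integrable \<mu> S"
  proof (rule Bochner_Integration.integrable_bound)
    show "integrable \<mu> (\<lambda>x. \<bar>S 0\<bar> + \<bar>x\<bar>)" using P1D(4)[OF \<mu>] by auto
    have "\<bar>S x\<bar> \<le> \<bar>S 0\<bar> + \<bar>x\<bar>" for x
      using lipschitz_onD[OF S, of x 0] by (auto simp: dist_real_def)
    then show "AE x in \<mu>. norm (S x) \<le> norm (\<bar>S 0\<bar> + \<bar>x\<bar>)" by (auto intro!: AE_I2)
  qed fact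
  then show "integrable \<mu> (\<lambda>x. \<bar>S x - y\<bar>)" by auto
  show "pushforward S \<mu> \<in> P1"
    using meas' int
    by (auto simp: P1_def pushforward_def real_distribution_def real_distribution_axioms_def
        prob_space_distr integrable_distr_eq)
  show "potential (pushforward S \<mu>) y = (\<integral>x. \<bar>S x - y\<bar> \<partial>\<mu>)"
    "(\<integral>x. x \<partial>(pushforward S \<mu>)) = (\<integral>x. S x \<partial>\<mu>)"
    using meas' by (auto simp: potential_def pushforward_def integral_distr)
qed

lemma integral_less_imp_ex_less:
  fixes u v :: "'a \<Rightarrow> real"
  assumes "integrable M u" "integrable M v" "(\<integral>x. u x \<partial>M) < (\<integral>x. v x \<partial>M)"
    and "AE x in M. x \<in> \<Gamma>"
  shows "\<exists>x\<in>\<Gamma>. u x < v x"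
proof (rule ccontr)
  assume "\<not> ?thesis"
  with assms(4) have "AE x in M. v x \<le> u x" by (auto elim!: eventually_mono)
  with assms(1-3) integral_mono_AE[of M v u] show False by simp
qed

text \<open>The complement of \<open>U\<close> is closed, so its part up to \<open>y\<close>
  contains its supremum. For \<open>y\<close> in \<open>U\<close> this is the left end point of the
  component of \<open>y\<close>.\<close>

lemma nearest_notin_below:
  fixes U :: "real set"
  assumes "open U" "z \<notin> U" "z \<le> y"
  shows "\<exists>a\<le>y. a \<notin> U \<and> {a<..y} \<subseteq> U"
proof -
  let ?A = "{..y} \<inter> - U"
  have "closed ?A" using assms(1) by auto
  moreover have "?A \<noteq> {}" "bdd_above ?A" using assms(2,3) by auto
  ultimately have "Sup ?A \<in> ?A" by (rule closed_contains_Sup[rotated 2])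
  moreover have "{Sup ?A<..y} \<subseteq> U"
    using cSup_upper[OF _ \<open>bdd_above ?A\<close>] by fastforce
  ultimately show ?thesis by auto
qed

lemma nearest_notin_above:
  fixes U :: "real set"
  assumes "open U" "z \<notin> U" "y \<le> z"
  shows "\<exists>b\<ge>y. b \<notin> U \<and> {y..<b} \<subseteq> U"
proof -
  have "open (uminus ` U)" "- z \<notin> uminus ` U" using assms(1,2) by (auto simp: open_negations)
  with assms(3) obtain a where a: "a \<le> - y" "a \<notin> uminus ` U" "{a<..- y} \<subseteq> uminus ` U"
    using nearest_notin_below[of "uminus ` U" "- z" "- y"] by auto
  have "{y..<- a} \<subseteq> U"
  proof
    fix w assume "w \<in> {y..<- a}"
    then have "- w \<in> {a<..- y}" by auto
    with a(3) have "- w \<in> uminus ` U" by (rule subsetD)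
    then show "w \<in> U" by auto
  qed
  moreover have "- a \<notin> U" using a(2) by (force simp: image_iff)
  ultimately show ?thesis using a(1) by (intro exI[of _ "- a"]) auto
qed

section \<open>Slope one on irreducible intervals implies maximality\<close>

text \<open>The assumed order gives the reverse inequality, so the two potentials coincide.\<close>

lemma slope_one_imp_potential_le:
  assumes P1: "\<mu> \<in> P1" "\<nu> \<in> P1" and S: "admissible \<mu> \<nu> S" and T: "admissible \<mu> \<nu> T"
    and le: "pushforward S \<mu> \<le>\<^sub>c pushforward T \<mu>"
    and slope: "\<And>I. I \<in> irreducible_intervals (pushforward S \<mu>) \<nu> \<Longrightarrow> has_slope_one_on \<mu> S (S -` I)"
  shows "potential (pushforward T \<mu>) y \<le> potential (pushforward S \<mu>) y"
proof (rule ccontr)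
  let ?S = "potential (pushforward S \<mu>)" and ?T = "potential (pushforward T \<mu>)"
  assume "\<not> ?T y \<le> ?S y"
  then have gap: "?S y < ?T y" by simp
  interpret prob_space \<mu> using P1D[OF P1(1)] by simp
  have lip: "1-lipschitz_on UNIV S" "1-lipschitz_on UNIV T"
    using S T by (auto simp: admissible_def)
  note push_S = pushforward_lipschitz[OF P1(1) lip(1)] and push_T = pushforward_lipschitz[OF P1(1) lip(2)]
  have ST: "?S w \<le> ?T w" for w
    using convex_order_imp_potential_le[OF push_S(4) push_T(4) le] .
  have T\<nu>: "?T w \<le> potential \<nu> w" for w
    using convex_order_imp_potential_le[OF push_T(4) P1(2)] T by (auto simp: admissible_def)
  have mean: "(\<integral>x. S x \<partial>\<mu>) = (\<integral>x. T x \<partial>\<mu>)"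
    using convex_order_imp_mean_eq[OF push_S(4) push_T(4) le] push_S(6) push_T(6) by simp
  define U where "U = {y. ?S y < potential \<nu> y}"
  have "open U"
    unfolding U_def using continuous_on_potential[OF push_S(4)] continuous_on_potential[OF P1(2)]
    by (intro open_Collect_less)
  have y: "y \<in> U" using gap T\<nu>[of y] by (simp add: U_def)
  have eq: "?T w = ?S w" if "w \<notin> U" for w
    using that ST[of w] T\<nu>[of w] by (simp add: U_def)
  define I where "I = connected_component_set U y"
  have "I \<in> irreducible_intervals (pushforward S \<mu>) \<nu>"
    using y by (auto simp: irreducible_intervals_def I_def U_def components_def)
  from slope[OF this] obtain \<Gamma> where \<Gamma>: "\<Gamma> \<in> sets borel" "prob \<Gamma> = 1"
    "\<And>x x'. x \<in> \<Gamma> \<Longrightarrow> S x \<in> I \<Longrightarrow> x' \<in> \<Gamma> \<Longrightarrow> S x' \<in> I \<Longrightarrow> S x - S x' = x - x'"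
    unfolding has_slope_one_on_def by blast
  have AE: "AE x in \<mu>. x \<in> \<Gamma>" using AE_prob_1[OF \<Gamma>(2)] .
  \<comment> \<open>The potentials agree at \<open>a\<close>, so subtracting the terms at
    \<open>a\<close> preserves the strict gap at \<open>y\<close>.\<close>
  have ex_less: "\<exists>x\<in>\<Gamma>. \<bar>S x - y\<bar> - \<bar>S x - a\<bar> < \<bar>T x - y\<bar> - \<bar>T x - a\<bar>" if "a \<notin> U" for a
    using gap eq[OF that] push_S(2,3,5) push_T(2,3,5)
    by (intro integral_less_imp_ex_less[OF _ _ _ AE]) auto
  have "\<exists>x\<in>\<Gamma>. T x < y \<and> T x < S x \<and> {S x..y} \<subseteq> U"
  proof (cases "\<exists>z\<le>y. z \<notin> U")
    case True
    then obtain a where a: "a \<le> y" "a \<notin> U" "{a<..y} \<subseteq> U"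
      using nearest_notin_below[OF \<open>open U\<close>] by blast
    obtain x where x: "x \<in> \<Gamma>" "\<bar>S x - y\<bar> - \<bar>S x - a\<bar> < \<bar>T x - y\<bar> - \<bar>T x - a\<bar>"
      using ex_less[OF a(2)] by blast
    \<comment> \<open>The function \<open>\<bar>t - y\<bar> - \<bar>t - a\<bar>\<close> of
      \<open>t\<close> is nonincreasing, maximal up to \<open>a\<close> and minimal from
      \<open>y\<close> on.\<close>
    with a(1) have "T x < y" "T x < S x" "a < S x" by linarith+
    with x(1) a(3) show ?thesis by (intro bexI[of _ x]) auto
  next
    case False
    \<comment> \<open>The component is unbounded below. Up to constants, \<open>t\<close> is the
      limit of \<open>\<bar>t - a\<bar>\<close> as \<open>a\<close> tends to minus infinity, and
      equality of means replaces equality of potentials at \<open>a\<close>.\<close>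
    have "\<exists>x\<in>\<Gamma>. \<bar>S x - y\<bar> - S x < \<bar>T x - y\<bar> - T x"
      using gap mean push_S(2,3,5) push_T(2,3,5)
      by (intro integral_less_imp_ex_less[OF _ _ _ AE]) auto
    then obtain x where x: "x \<in> \<Gamma>" "\<bar>S x - y\<bar> - S x < \<bar>T x - y\<bar> - T x" by blast
    then have "T x < y" "T x < S x" by linarith+
    with x(1) False show ?thesis by (intro bexI[of _ x]) auto
  qed
  then obtain x1 where x1: "x1 \<in> \<Gamma>" "T x1 < y" "T x1 < S x1" "{S x1..y} \<subseteq> U" by blast
  have "\<exists>x\<in>\<Gamma>. y < T x \<and> S x < T x \<and> {y..S x} \<subseteq> U"
  proof (cases "\<exists>z\<ge>y. z \<notin> U")
    case True
    then obtain b where b: "b \<ge> y" "b \<notin> U" "{y..<b} \<subseteq> U"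
      using nearest_notin_above[OF \<open>open U\<close>] by blast
    obtain x where x: "x \<in> \<Gamma>" "\<bar>S x - y\<bar> - \<bar>S x - b\<bar> < \<bar>T x - y\<bar> - \<bar>T x - b\<bar>"
      using ex_less[OF b(2)] by blast
    with b(1) have "y < T x" "S x < T x" "S x < b" by linarith+
    with x(1) b(3) show ?thesis by (intro bexI[of _ x]) auto
  next
    case False
    have "\<exists>x\<in>\<Gamma>. \<bar>S x - y\<bar> + S x < \<bar>T x - y\<bar> + T x"
      using gap mean push_S(2,3,5) push_T(2,3,5)
      by (intro integral_less_imp_ex_less[OF _ _ _ AE]) auto
    then obtain x where x: "x \<in> \<Gamma>" "\<bar>S x - y\<bar> + S x < \<bar>T x - y\<bar> + T x" by blast
    then have "y < T x" "S x < T x" by linarith+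
    with x(1) False show ?thesis by (intro bexI[of _ x]) auto
  qed
  then obtain x2 where x2: "x2 \<in> \<Gamma>" "y < T x2" "S x2 < T x2" "{y..S x2} \<subseteq> U" by blast
  have "x1 \<le> x2"
    using x1(2) x2(2) admissible_increment(1)[OF T, of x2 x1] by (cases "x1 \<le> x2") auto
  then have S_le: "S x1 \<le> S x2" and T_le: "T x2 - T x1 \<le> x2 - x1"
    using admissible_increment[OF S] admissible_increment[OF T] by auto
  \<comment> \<open>\<open>S x1\<close> may lie above \<open>y\<close> and \<open>S x2\<close> below
    it; enlarging the segment by \<open>y\<close> ties it to the component of
    \<open>y\<close>.\<close>
  have "{min (S x1) y..max (S x2) y} \<subseteq> I"
    unfolding I_def
  proof (rule connected_component_maximal)
    show "{min (S x1) y..max (S x2) y} \<subseteq> U"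
    proof
      fix w assume w: "w \<in> {min (S x1) y..max (S x2) y}"
      show "w \<in> U"
      proof (cases "w = y")
        case False
        with w have "w \<in> {S x1..y} \<or> w \<in> {y..S x2}" by auto
        with x1(4) x2(4) show ?thesis by blast
      qed (simp add: y)
    qed
  qed auto
  with S_le have "S x1 \<in> I" "S x2 \<in> I" by (auto simp: subset_iff)
  then have "S x2 - S x1 = x2 - x1" using \<Gamma>(3) x1(1) x2(1) by blast
  with T_le x1(3) x2(3) show False by linarith
qed

section \<open>Increasing maps with equal potentials\<close>

text \<open>The function \<open>\<bar>t - p\<bar> - \<bar>t - q\<bar>\<close> is least for
  \<open>t \<le> p\<close> and greatest for \<open>t \<ge> q\<close>. Around a separated
  \<open>x0\<close>, \<open>S\<close> attains the least value on the left and \<open>T\<close> the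
  greatest on the right, so \<open>?h\<close> is nonnegative. Its integral is 0, but it is positive
  at separated points.\<close>

lemma mono_potential_eq_imp_AE_not_separated:
  fixes S T :: "real \<Rightarrow> real"
  assumes "mono S" "mono T" "integrable \<mu> S" "integrable \<mu> T" "finite_measure \<mu>"
    and eq: "\<And>y. (\<integral>x. \<bar>S x - y\<bar> \<partial>\<mu>) = (\<integral>x. \<bar>T x - y\<bar> \<partial>\<mu>)"
    and "p < q"
  shows "AE x in \<mu>. \<not> (S x \<le> p \<and> q \<le> T x)"
proof (cases "\<exists>x. S x \<le> p \<and> q \<le> T x")
  case True
  then obtain x0 where x0: "S x0 \<le> p" "q \<le> T x0" by blast
  interpret finite_measure \<mu> by fact
  let ?h = "\<lambda>x. (\<bar>T x - p\<bar> - \<bar>T x - q\<bar>) - (\<bar>S x - p\<bar> - \<bar>S x - q\<bar>)"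
  have int: "integrable \<mu> (\<lambda>x. \<bar>S x - y\<bar>)" "integrable \<mu> (\<lambda>x. \<bar>T x - y\<bar>)" for y
    using assms(3,4) by auto
  have nonneg: "0 \<le> ?h x" for x
  proof (cases "x \<le> x0")
    case True
    with monoD[OF assms(1) True] x0 \<open>p < q\<close> show ?thesis by auto
  next
    case False
    then have "T x0 \<le> T x" using monoD[OF assms(2), of x0 x] by simp
    with x0 \<open>p < q\<close> show ?thesis by auto
  qed
  have "(\<integral>x. ?h x \<partial>\<mu>) = 0" using int eq by simp
  moreover have "integrable \<mu> ?h" using int by auto
  ultimately have "AE x in \<mu>. ?h x = 0"
    using nonneg integral_nonneg_eq_0_iff_AE[of \<mu> ?h] by auto
  then show ?thesis
  proof eventually_elim
    case (elim x)
    with \<open>p < q\<close> show ?case by auto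
  qed
qed auto

text \<open>Wherever \<open>S x < T x\<close>, two rationals separate the values, so countably many
  null sets suffice.\<close>

lemma mono_potential_eq_imp_AE_le:
  fixes S T :: "real \<Rightarrow> real"
  assumes "mono S" "mono T" "integrable \<mu> S" "integrable \<mu> T" "finite_measure \<mu>"
    and eq: "\<And>y. (\<integral>x. \<bar>S x - y\<bar> \<partial>\<mu>) = (\<integral>x. \<bar>T x - y\<bar> \<partial>\<mu>)"
  shows "AE x in \<mu>. T x \<le> S x"
proof -
  have "AE x in \<mu>. \<forall>p\<in>\<rat>. \<forall>q\<in>\<rat>. p < q \<longrightarrow> \<not> (S x \<le> p \<and> q \<le> T x)"
    using mono_potential_eq_imp_AE_not_separated[OF assms]
    by (simp add: AE_ball_countable countable_rat)
  then show ?thesis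
  proof eventually_elim
    case (elim x)
    show ?case
    proof (rule ccontr)
      assume "\<not> T x \<le> S x"
      then obtain p where p: "p \<in> \<rat>" "S x < p" "p < T x" using Rats_dense_in_real[of "S x" "T x"] by auto
      then obtain q where q: "q \<in> \<rat>" "p < q" "q < T x" using Rats_dense_in_real[of p "T x"] by auto
      with elim[rule_format, of p q] p show False by simp
    qed
  qed
qed

section \<open>Maximality implies slope one on irreducible intervals\<close>

text \<open>The displacement \<open>x - T x\<close> is nondecreasing. If mass with smaller displacement than at \<open>z\<close> is
  sent above \<open>\<alpha>\<close> and mass with larger displacement is sent below \<open>\<beta>\<close>, the former can be pushed
  further down and the latter further up, along the line of slope one through \<open>(z, T z)\<close>.
  This spreads the image, and a small enough amount of it stays below \<open>\<nu>\<close>, because the potentials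
  are uniformly apart on \<open>[\<alpha>, \<beta>]\<close> and nothing changes outside.\<close>

lemma spread_admissible:
  assumes P1: "\<mu> \<in> P1" "\<nu> \<in> P1" and T: "admissible \<mu> \<nu> T"
    and gap: "{\<alpha>..\<beta>} \<subseteq> {y. potential (pushforward T \<mu>) y < potential \<nu> y}"
    and \<alpha>: "\<alpha> \<le> T z" and \<beta>: "T z \<le> \<beta>"
    and left: "\<not> (AE x in \<mu>. \<not> (x - T x < z - T z \<and> \<alpha> < T x))"
    and right: "\<not> (AE x in \<mu>. \<not> (z - T z < x - T x \<and> T x < \<beta>))"
  shows "\<exists>S. admissible \<mu> \<nu> S \<and>
    potential (pushforward T \<mu>) (T z) < potential (pushforward S \<mu>) (T z)"
proof -
  interpret prob_space \<mu> using P1D[OF P1(1)] by simp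
  note inc = admissible_increment[OF T]
  have "1-lipschitz_on UNIV T" using T by (simp add: admissible_def)
  note push_T = pushforward_lipschitz[OF P1(1) this]
  let ?T = "potential (pushforward T \<mu>)"
  \<comment> \<open>\<open>S1\<close> lowers \<open>T\<close> to the line of slope one, but not
    below \<alpha>; it differs from \<open>T\<close> exactly on the event in \<open>left\<close>, to
    the left of \<open>z\<close>. \<open>S2\<close> is the mirror image.\<close>
  define S1 where "S1 x = min (T x) (max (T z + x - z) \<alpha>)" for x
  define S2 where "S2 x = max (T x) (min (T z + x - z) \<beta>)" for x
  have inc1: "S1 x \<le> S1 y \<and> S1 y - S1 x \<le> y - x" and inc2: "S2 x \<le> S2 y \<and> S2 y - S2 x \<le> y - x"
    if "x \<le> y" for x y
    using inc[OF that] that by (auto simp: S1_def S2_def)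
  have "1-lipschitz_on UNIV S1" "1-lipschitz_on UNIV S2"
    using inc1 inc2 mono_lipschitz_iff[of S1] mono_lipschitz_iff[of S2] by blast+
  then have int[simp]: "integrable \<mu> S1" "integrable \<mu> S2" "integrable \<mu> T"
    using pushforward_lipschitz(2)[OF P1(1)] push_T(2) by blast+
  define L where "L = (\<integral>x. T x - S1 x \<partial>\<mu>)"
  define R where "R = (\<integral>x. S2 x - T x \<partial>\<mu>)"
  have S1_le: "S1 x \<le> T x" and S2_ge: "T x \<le> S2 x" for x by (auto simp: S1_def S2_def)
  have "L \<noteq> 0"
  proof
    assume "L = 0"
    then have "AE x in \<mu>. T x - S1 x = 0"
      using integral_nonneg_eq_0_iff_AE[of \<mu> "\<lambda>x. T x - S1 x"] S1_le by (simp add: L_def)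
    then have "AE x in \<mu>. \<not> (x - T x < z - T z \<and> \<alpha> < T x)"
      by eventually_elim (auto simp: S1_def)
    with left show False by simp
  qed
  moreover have "R \<noteq> 0"
  proof
    assume "R = 0"
    then have "AE x in \<mu>. S2 x - T x = 0"
      using integral_nonneg_eq_0_iff_AE[of \<mu> "\<lambda>x. S2 x - T x"] S2_ge by (simp add: R_def)
    then have "AE x in \<mu>. \<not> (z - T z < x - T x \<and> T x < \<beta>)"
      by eventually_elim (auto simp: S2_def)
    with right show False by simp
  qed
  moreover have "0 \<le> L" "0 \<le> R"
    unfolding L_def R_def using S1_le S2_ge by (auto intro!: integral_mono)
  ultimately have LR: "0 < L" "0 < R" by auto
  have "\<exists>\<delta>>0. \<forall>y\<in>{\<alpha>..\<beta>}. \<delta> \<le> potential \<nu> y - ?T y"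
  proof -
    have "continuous_on {\<alpha>..\<beta>} (\<lambda>y. potential \<nu> y - ?T y)"
      using continuous_on_potential[OF P1(2)] continuous_on_potential[OF push_T(4)]
      by (intro continuous_intros) (auto elim: continuous_on_subset)
    then have "\<exists>w\<in>{\<alpha>..\<beta>}. \<forall>y\<in>{\<alpha>..\<beta>}. potential \<nu> w - ?T w \<le> potential \<nu> y - ?T y"
      using \<alpha> \<beta> by (intro continuous_attains_inf) auto
    then obtain w where "w \<in> {\<alpha>..\<beta>}" "\<forall>y\<in>{\<alpha>..\<beta>}. potential \<nu> w - ?T w \<le> potential \<nu> y - ?T y" by blast
    moreover from this gap have "?T w < potential \<nu> w" by blast
    ultimately show ?thesis by (intro exI[of _ "potential \<nu> w - ?T w"]) simp
  qed
  then obtain \<delta> where \<delta>: "\<delta> > 0" "\<And>y. y \<in> {\<alpha>..\<beta>} \<Longrightarrow> \<delta> \<le> potential \<nu> y - ?T y" by blast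
  \<comment> \<open>The weights \<open>s = e * R\<close> and \<open>r = e * L\<close> are taken
    crosswise so that the mean is preserved. The first bound gives \<open>s + r \<le> 1\<close>, the
    second keeps the growth \<open>2 * e * L * R\<close> of potentials within \<delta>.\<close>
  define e where "e = min (1 / (L + R)) (\<delta> / (2 * L * R))"
  have "0 < e" using LR \<delta>(1) by (simp add: e_def)
  have "e \<le> 1 / (L + R)" "e \<le> \<delta> / (2 * L * R)" by (auto simp: e_def)
  with LR have e_le: "e * R + e * L \<le> 1" "2 * (e * R * L) \<le> \<delta>"
    by (simp_all add: pos_le_divide_eq algebra_simps)
  define s where "s = e * R"
  define r where "r = e * L"
  have sr: "0 < s" "0 < r" "s + r \<le> 1" "s * L = r * R" "s * L + r * R \<le> \<delta>"
    using e_le \<open>0 < e\<close> LR by (simp_all add: s_def r_def mult_ac)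
  define S where "S x = T x - s * (T x - S1 x) + r * (S2 x - T x)" for x
  have incS: "S x \<le> S y \<and> S y - S x \<le> y - x" if "x \<le> y" for x y
  proof -
    \<comment> \<open>\<open>S\<close> is a convex combination of \<open>T\<close>,
      \<open>S1\<close> and \<open>S2\<close>.\<close>
    have S_diff: "S y - S x = (1 - s - r) * (T y - T x) + s * (S1 y - S1 x) + r * (S2 y - S2 x)"
      by (simp add: S_def algebra_simps)
    have "0 \<le> S y - S x"
      unfolding S_diff using sr inc(1)[OF that] inc1[OF that] inc2[OF that] by auto
    moreover have "S y - S x \<le> (1 - s - r) * (y - x) + s * (y - x) + r * (y - x)"
      unfolding S_diff using sr inc(2)[OF that] inc1[OF that] inc2[OF that]
      by (intro add_mono mult_left_mono) auto
    ultimately show ?thesis by (simp add: algebra_simps)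
  qed
  then have S: "mono S" "1-lipschitz_on UNIV S" using mono_lipschitz_iff[of S] by auto
  note push_S = pushforward_lipschitz[OF P1(1) S(2)]
  let ?S = "potential (pushforward S \<mu>)"
  have int_S: "(\<integral>x. S x \<partial>\<mu>) = (\<integral>x. T x \<partial>\<mu>)"
    using sr(4) by (simp add: S_def L_def R_def)
  \<comment> \<open>Every point that moves stays within the interval from \<alpha> to \<beta> and
    moves away from \<open>T z\<close>, so the potential at \<open>T z\<close> grows by the full
    amount moved.\<close>
  have S_cases: "(\<alpha> \<le> S x \<and> \<alpha> \<le> T x \<and> S x \<le> \<beta> \<and> T x \<le> \<beta> \<or> S x = T x) \<and>
    \<bar>S x - T z\<bar> = \<bar>T x - T z\<bar> + (s * (T x - S1 x) + r * (S2 x - T x))" for x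
  proof -
    have s_bd: "0 \<le> s * (T x - S1 x)" "s * (T x - S1 x) \<le> T x - S1 x"
      using sr S1_le[of x] by (auto intro: mult_left_le_one_le)
    have r_bd: "0 \<le> r * (S2 x - T x)" "r * (S2 x - T x) \<le> S2 x - T x"
      using sr S2_ge[of x] by (auto intro: mult_left_le_one_le)
    show ?thesis
    proof (cases "x \<le> z")
      case True
      then have "S2 x = T x" "T x \<le> T z" using inc[OF True] by (auto simp: S2_def)
      moreover have "S1 x = T x \<or> \<alpha> \<le> S1 x" by (auto simp: S1_def)
      ultimately show ?thesis using s_bd S1_le[of x] \<beta> by (auto simp: S_def)
    next
      case False
      then have "S1 x = T x" "T z \<le> T x" using inc[of z x] by (auto simp: S1_def)
      moreover have "S2 x = T x \<or> S2 x \<le> \<beta>" by (auto simp: S2_def)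
      ultimately show ?thesis using r_bd S2_ge[of x] \<alpha> by (auto simp: S_def)
    qed
  qed
  have "?S y \<le> potential \<nu> y" for y
  proof -
    have T\<nu>: "?T y \<le> potential \<nu> y"
      using convex_order_imp_potential_le[OF push_T(4) P1(2)] T by (auto simp: admissible_def)
    consider "y < \<alpha>" | "\<beta> < y" | "y \<in> {\<alpha>..\<beta>}" by fastforce
    then show ?thesis
    proof cases
      case 1
      \<comment> \<open>Moved points stay on one side of \<open>y\<close>, so the change is
        \<open>S x - T x\<close>, whose integral is 0.\<close>
      have "\<bar>S x - y\<bar> = \<bar>T x - y\<bar> + (S x - T x)" for x using S_cases[of x] 1 by auto
      then have "?S y = ?T y" using push_S(2) push_T(3) int_S by (simp add: push_S(5) push_T(5))
      with T\<nu> show ?thesis by simp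
    next
      case 2
      have "\<bar>S x - y\<bar> = \<bar>T x - y\<bar> - (S x - T x)" for x using S_cases[of x] 2 by auto
      then have "?S y = ?T y" using push_S(2) push_T(3) int_S by (simp add: push_S(5) push_T(5))
      with T\<nu> show ?thesis by simp
    next
      case 3
      have "\<bar>S x - y\<bar> \<le> \<bar>T x - y\<bar> + (s * (T x - S1 x) + r * (S2 x - T x))" for x
      proof -
        have "0 \<le> s * (T x - S1 x)" "0 \<le> r * (S2 x - T x)" using sr S1_le[of x] S2_ge[of x] by auto
        then show ?thesis by (auto simp: S_def)
      qed
      then have "?S y \<le> (\<integral>x. \<bar>T x - y\<bar> + (s * (T x - S1 x) + r * (S2 x - T x)) \<partial>\<mu>)"
        unfolding push_S(5) using push_S(3) push_T(3) by (intro integral_mono) auto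
      also have "\<dots> = ?T y + (s * L + r * R)"
        using push_T(3) by (simp add: push_T(5) L_def R_def)
      finally show ?thesis using \<delta>(2)[OF 3] sr(5) by simp
    qed
  qed
  moreover have "(\<integral>x. x \<partial>(pushforward S \<mu>)) = (\<integral>x. x \<partial>\<nu>)"
    using convex_order_imp_mean_eq[OF push_T(4) P1(2)] T int_S push_S(6) push_T(6)
    by (simp add: admissible_def)
  ultimately have "pushforward S \<mu> \<le>\<^sub>c \<nu>"
    by (intro convex_orderI push_S(4) P1(2))
  moreover have "?S (T z) = ?T (T z) + (s * L + r * R)"
    using push_T(3) S_cases by (simp add: push_S(5) push_T(5) L_def R_def)
  moreover have "0 < s * L + r * R" using sr(1,2) LR by (intro add_pos_pos mult_pos_pos)
  ultimately show ?thesis using S by (intro exI[of _ S]) (auto simp: admissible_def)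
qed

lemma open_real_Rats_below:
  assumes "open I" "x \<in> (I :: real set)"
  shows "\<exists>q\<in>\<rat> \<inter> I. q < x"
proof -
  obtain e where e: "e > 0" "ball x e \<subseteq> I" using assms openE by blast
  obtain q where "q \<in> \<rat>" "x - e < q" "q < x" using Rats_dense_in_real[of "x - e" x] e(1) by auto
  moreover from this e(2) have "q \<in> I" by (auto simp: dist_real_def subset_iff)
  ultimately show ?thesis by blast
qed

lemma open_real_Rats_above:
  assumes "open I" "x \<in> (I :: real set)"
  shows "\<exists>q\<in>\<rat> \<inter> I. x < q"
proof -
  obtain e where e: "e > 0" "ball x e \<subseteq> I" using assms openE by blast
  obtain q where "q \<in> \<rat>" "x < q" "q < x + e" using Rats_dense_in_real[of x "x + e"] e(1) by auto
  moreover from this e(2) have "q \<in> I" by (auto simp: dist_real_def subset_iff)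
  ultimately show ?thesis by blast
qed

text \<open>If both kinds of mass were present over \<open>I\<close>, spreading the image would give
  an admissible map with a larger potential at \<open>T z\<close>, against maximality.\<close>

lemma maximal_imp_displacement_AE:
  assumes P1: "\<mu> \<in> P1" "\<nu> \<in> P1" and T: "weak_monotone_rearrangement \<mu> \<nu> T"
    and I: "I \<in> irreducible_intervals (pushforward T \<mu>) \<nu>" and z: "T z \<in> I"
  shows "(AE x in \<mu>. \<not> (T x \<in> I \<and> x - T x < z - T z)) \<or>
    (AE x in \<mu>. \<not> (T x \<in> I \<and> z - T z < x - T x))"
proof (rule ccontr)
  let ?U = "{y. potential (pushforward T \<mu>) y < potential \<nu> y}"
  assume neg: "\<not> ?thesis"
  have adm: "admissible \<mu> \<nu> T" using T by (simp add: weak_monotone_rearrangement_def)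
  note inc = admissible_increment[OF adm]
  have lip: "1-lipschitz_on UNIV T" if "admissible \<mu> \<nu> T" for T
    using that by (simp add: admissible_def)
  note push_T = pushforward_lipschitz[OF P1(1) lip[OF adm]]
  have "open ?U"
    using continuous_on_potential[OF push_T(4)] continuous_on_potential[OF P1(2)]
    by (intro open_Collect_less)
  then have "open I" using I by (auto simp: irreducible_intervals_def intro: open_components)
  have I_sub: "I \<subseteq> ?U" "connected I"
    using I by (auto simp: irreducible_intervals_def dest: in_components_subset in_components_connected)
  \<comment> \<open>As \<open>I\<close> is open, the rational thresholds in it exhaust the event. If
    each truncated event were null, so would be their countable union.\<close>
  have "\<exists>\<alpha>\<in>\<rat> \<inter> I. \<alpha> \<le> T z \<and> \<not> (AE x in \<mu>. \<not> (x - T x < z - T z \<and> \<alpha> < T x))"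
  proof (rule ccontr)
    assume "\<not> ?thesis"
    then have "\<forall>\<alpha>\<in>\<rat> \<inter> I. AE x in \<mu>. \<alpha> \<le> T z \<longrightarrow> \<not> (x - T x < z - T z \<and> \<alpha> < T x)" by auto
    then have "AE x in \<mu>. \<forall>\<alpha>\<in>\<rat> \<inter> I. \<alpha> \<le> T z \<longrightarrow> \<not> (x - T x < z - T z \<and> \<alpha> < T x)"
      by (subst AE_ball_countable) (auto intro: countable_rat countable_Int1)
    then have "AE x in \<mu>. \<not> (T x \<in> I \<and> x - T x < z - T z)"
    proof eventually_elim
      case (elim x)
      show ?case
      proof
        assume x: "T x \<in> I \<and> x - T x < z - T z"
        then have "T x \<le> T z" using inc[of z x] inc[of x z] by (cases "x \<le> z") auto
        moreover obtain \<alpha> where \<alpha>: "\<alpha> \<in> \<rat> \<inter> I" "\<alpha> < T x"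
          using open_real_Rats_below[OF \<open>open I\<close>] x by blast
        ultimately show False using elim[rule_format, OF \<alpha>(1)] x by simp
      qed
    qed
    with neg show False by simp
  qed
  then obtain \<alpha> where \<alpha>: "\<alpha> \<in> I" "\<alpha> \<le> T z"
    "\<not> (AE x in \<mu>. \<not> (x - T x < z - T z \<and> \<alpha> < T x))" by blast
  have "\<exists>\<beta>\<in>\<rat> \<inter> I. T z \<le> \<beta> \<and> \<not> (AE x in \<mu>. \<not> (z - T z < x - T x \<and> T x < \<beta>))"
  proof (rule ccontr)
    assume "\<not> ?thesis"
    then have "\<forall>\<beta>\<in>\<rat> \<inter> I. AE x in \<mu>. T z \<le> \<beta> \<longrightarrow> \<not> (z - T z < x - T x \<and> T x < \<beta>)" by auto
    then have "AE x in \<mu>. \<forall>\<beta>\<in>\<rat> \<inter> I. T z \<le> \<beta> \<longrightarrow> \<not> (z - T z < x - T x \<and> T x < \<beta>)"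
      by (subst AE_ball_countable) (auto intro: countable_rat countable_Int1)
    then have "AE x in \<mu>. \<not> (T x \<in> I \<and> z - T z < x - T x)"
    proof eventually_elim
      case (elim x)
      show ?case
      proof
        assume x: "T x \<in> I \<and> z - T z < x - T x"
        then have "T z \<le> T x" using inc[of z x] inc[of x z] by (cases "z \<le> x") auto
        moreover obtain \<beta> where \<beta>: "\<beta> \<in> \<rat> \<inter> I" "T x < \<beta>"
          using open_real_Rats_above[OF \<open>open I\<close>] x by blast
        ultimately show False using elim[rule_format, OF \<beta>(1)] x by simp
      qed
    qed
    with neg show False by simp
  qed
  then obtain \<beta> where \<beta>: "\<beta> \<in> I" "T z \<le> \<beta>"
    "\<not> (AE x in \<mu>. \<not> (z - T z < x - T x \<and> T x < \<beta>))" by blast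
  have "{\<alpha>..\<beta>} \<subseteq> ?U"
    using connected_contains_Icc[OF I_sub(2) \<alpha>(1) \<beta>(1)] I_sub(1) by (rule order_trans)
  from spread_admissible[OF P1 adm this \<alpha>(2) \<beta>(2) \<alpha>(3) \<beta>(3)]
  obtain S where S: "admissible \<mu> \<nu> S"
    "potential (pushforward T \<mu>) (T z) < potential (pushforward S \<mu>) (T z)" by blast
  have "pushforward S \<mu> \<le>\<^sub>c pushforward T \<mu>"
    using T S(1) by (simp add: weak_monotone_rearrangement_def)
  from convex_order_imp_potential_le[OF pushforward_lipschitz(4)[OF P1(1) lip[OF S(1)]] push_T(4) this]
  show False using S(2) by (simp add: not_less[symmetric])
qed

text \<open>The null set for a single \<open>z\<close> depends on its displacement, so only rational
  levels are collected. Two good points with different displacements have a rational level between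
  them, attained by continuity at some \<open>z\<close> with \<open>T z\<close> in \<open>I\<close>;
  one of the two would then lie in an excluded null set.\<close>

lemma maximal_imp_slope_one:
  assumes P1: "\<mu> \<in> P1" "\<nu> \<in> P1" and T: "weak_monotone_rearrangement \<mu> \<nu> T"
    and I: "I \<in> irreducible_intervals (pushforward T \<mu>) \<nu>"
  shows "has_slope_one_on \<mu> T (T -` I)"
proof -
  interpret prob_space \<mu> using P1D[OF P1(1)] by simp
  have adm: "admissible \<mu> \<nu> T" using T by (simp add: weak_monotone_rearrangement_def)
  note inc = admissible_increment[OF adm]
  define below where "below q \<longleftrightarrow> (AE x in \<mu>. \<not> (T x \<in> I \<and> x - T x < q))" for q
  define above where "above q \<longleftrightarrow> (AE x in \<mu>. \<not> (T x \<in> I \<and> q < x - T x))" for q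
  define good where "good x \<longleftrightarrow> (\<forall>q\<in>\<rat>. (below q \<longrightarrow> \<not> (T x \<in> I \<and> x - T x < q)) \<and>
    (above q \<longrightarrow> \<not> (T x \<in> I \<and> q < x - T x)))" for x
  have "AE x in \<mu>. good x"
    unfolding good_def
    by (subst AE_ball_countable) (auto simp: below_def above_def intro: countable_rat)
  then obtain N where N: "N \<in> null_sets \<mu>" "{x \<in> space \<mu>. \<not> good x} \<subseteq> N"
    by (auto simp: eventually_ae_filter)
  have good: "good x" if "x \<in> space \<mu> - N" for x using N(2) that by auto
  have le: "y - T y \<le> x - T x" if "good x" "good y" "T x \<in> I" "T y \<in> I" for x y
  proof (rule ccontr)
    assume "\<not> ?thesis"
    then have less: "x - T x < y - T y" by simp
    then have "x \<le> y" using inc(2)[of y x] by (cases "x \<le> y") auto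
    obtain q where q: "q \<in> \<rat>" "x - T x < q" "q < y - T y" using Rats_dense_in_real[OF less] by auto
    have "continuous_on UNIV T"
      using adm by (auto simp: admissible_def intro: lipschitz_on_continuous_on)
    then have "continuous_on {x..y} (\<lambda>x. x - T x)"
      by (intro continuous_intros) (rule continuous_on_subset, auto)
    then obtain z where z: "x \<le> z" "z \<le> y" "z - T z = q"
      using IVT'[of "\<lambda>x. x - T x" x q y] q \<open>x \<le> y\<close> by auto
    have "connected I"
      using I by (auto simp: irreducible_intervals_def dest: in_components_connected)
    from connected_contains_Icc[OF this \<open>T x \<in> I\<close> \<open>T y \<in> I\<close>] have "T z \<in> I"
      using inc(1) z by auto
    from maximal_imp_displacement_AE[OF P1 T I this] have "below q \<or> above q"
      by (simp add: z(3) below_def above_def)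
    with that q show False by (auto simp: good_def)
  qed
  show ?thesis
    unfolding has_slope_one_on_def
  proof (intro bexI[of _ "space \<mu> - N"] conjI ballI)
    show "space \<mu> - N \<in> sets borel" using N(1) P1D(2)[OF P1(1)] by (auto simp: null_sets_def)
    show "measure \<mu> (space \<mu> - N) = 1"
      using N(1) by (subst prob_compl) (auto simp: measure_eq_0_null_sets)
    show "T x - T y = x - y" if "x \<in> (space \<mu> - N) \<inter> T -` I" "y \<in> (space \<mu> - N) \<inter> T -` I" for x y
      using le[of x y] le[of y x] good that by auto
  qed
qed

theorem theorem1p3:
  fixes \<mu> \<nu> :: "real measure" and T :: "real \<Rightarrow> real"
  assumes "\<mu> \<in> P1" and "\<nu> \<in> P1"
    and "weak_monotone_rearrangement \<mu> \<nu> T"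
  shows "admissible \<mu> \<nu> T \<and>
    (\<forall>I \<in> irreducible_intervals (pushforward T \<mu>) \<nu>. has_slope_one_on \<mu> T (T -` I)) \<and>
    (\<forall>S. admissible \<mu> \<nu> S \<and>
         (\<forall>I \<in> irreducible_intervals (pushforward S \<mu>) \<nu>. has_slope_one_on \<mu> S (S -` I))
       \<longrightarrow> (AE x in \<mu>. S x = T x))"
proof (intro conjI ballI allI impI)
  show adm: "admissible \<mu> \<nu> T"
    using assms(3) by (simp add: weak_monotone_rearrangement_def)
  show "has_slope_one_on \<mu> T (T -` I)" if "I \<in> irreducible_intervals (pushforward T \<mu>) \<nu>" for I
    using maximal_imp_slope_one[OF assms that] .
  fix S
  assume *: "admissible \<mu> \<nu> S \<and>
    (\<forall>I \<in> irreducible_intervals (pushforward S \<mu>) \<nu>. has_slope_one_on \<mu> S (S -` I))"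
  then have S: "admissible \<mu> \<nu> S" by simp
  have le: "pushforward S \<mu> \<le>\<^sub>c pushforward T \<mu>"
    using assms(3) S by (simp add: weak_monotone_rearrangement_def)
  have mono: "mono S" "mono T" and lip: "1-lipschitz_on UNIV S" "1-lipschitz_on UNIV T"
    using S adm by (auto simp: admissible_def)
  note push_S = pushforward_lipschitz[OF assms(1) lip(1)]
    and push_T = pushforward_lipschitz[OF assms(1) lip(2)]
  \<comment> \<open>Slope one gives one inequality of potentials, maximality of \<open>T\<close> the
    other.\<close>
  have eq: "(\<integral>x. \<bar>S x - y\<bar> \<partial>\<mu>) = (\<integral>x. \<bar>T x - y\<bar> \<partial>\<mu>)" for y
    using slope_one_imp_potential_le[OF assms(1,2) S adm le, of y] *
      convex_order_imp_potential_le[OF push_S(4) push_T(4) le, of y]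
    by (simp add: push_S(5) push_T(5))
  interpret prob_space \<mu> using P1D[OF assms(1)] by simp
  have "AE x in \<mu>. T x \<le> S x" "AE x in \<mu>. S x \<le> T x"
    using mono_potential_eq_imp_AE_le[OF mono push_S(2) push_T(2) _ eq]
      mono_potential_eq_imp_AE_le[OF mono(2,1) push_T(2) push_S(2) _ eq[symmetric]]
      finite_measure_axioms by auto
  then show "AE x in \<mu>. S x = T x" by eventually_elim simp
qed

end
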